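(* Let $y\in\mathbb{C}$ satisfy $e^{2iy}\neq q^{m}$ for all $m\in\mathbb{Z}$. Suppose that $f$ is a meromorphic function on $\mathbb{C}$ which has only simple poles, that $\mathcal{P}=\{a_1,a_2,\ldots,a_n\}$ is a complete set of inequivalent poles of $f$, and that $f$ satisfies the functional equations $$f(z)=f(z+\pi)=e^{2iy}f(z+\pi\tau).$$ Then $$f(z)=\sum_{k=1}^{n}\mathrm{res}(f;a_k)\,K_y(z-a_k|\tau).$$
   Context: Fix $\tau\in\mathbb{C}$ with $\mathrm{Im}\,\tau>0$ and put $q=e^{2\pi i\tau}$. The Jacobi theta function is the entire function $\theta_1(z|\tau)=2\sum_{n=0}^\infty(-1)^n q^{(2n+1)^2/8}\sin((2n+1)z)$, where $q^{s}$ means $e^{2\pi i s\tau}$; a prime denotes the derivative with respect to the first variable $z$. For $y,z$ not zeros of $\theta_1(\cdot|\tau)$, the Kronecker theta function is $$K_y(z|\tau)=\frac{\theta_1'(0|\tau)\,\theta_1(z+y|\tau)}{\theta_1(z|\tau)\,\theta_1(y|\tau)}.$$ Let $\Lambda=\{m\pi+n\pi\tau:(m,n)\in\mathbb{Z}^2\}$. Two complex numbers are equivalent if their difference lies in $\Lambda$ and inequivalent otherwise. A complete set of inequivalent poles of $f$ is a set of pairwise inequivalent poles such that every pole of $f$ is equivalent to one of them. $\mathrm{res}(f;a)$ is the residue of $f$ at $a$. The identity is one of meromorphic functions of $z$. *)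

theory Defs
  imports "HOL-Complex_Analysis.Complex_Analysis"
begin

(* The power q^s of q = exp (2 pi i tau), with the branch fixed by tau. *)
definition qpow :: "complex \<Rightarrow> real \<Rightarrow> complex" where
  "qpow \<tau> s = exp (2 * of_real pi * \<i> * of_real s * \<tau>)"

definition theta1 :: "complex \<Rightarrow> complex \<Rightarrow> complex" where
  "theta1 \<tau> z =
     2 * (\<Sum>n. (-1) ^ n * qpow \<tau> ((2 * real n + 1)\<^sup>2 / 8) * sin ((2 * of_nat n + 1) * z))"

(* Division by zero gives 0 here, so the value is a junk value when y or z is a zero of
   theta1; as z varies this only concerns a discrete set. *)
definition kronecker_theta :: "complex \<Rightarrow> complex \<Rightarrow> complex \<Rightarrow> complex" where
  "kronecker_theta \<tau> y z =
     (deriv (theta1 \<tau>) 0 * theta1 \<tau> (z + y)) / (theta1 \<tau> z * theta1 \<tau> y)"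

definition period_lattice :: "complex \<Rightarrow> complex set" where
  "period_lattice \<tau> = {of_int m * of_real pi + of_int n * of_real pi * \<tau> | m n :: int. True}"

definition lattice_equiv :: "complex \<Rightarrow> complex \<Rightarrow> complex \<Rightarrow> bool" where
  "lattice_equiv \<tau> z w \<longleftrightarrow> z - w \<in> period_lattice \<tau>"

definition complete_inequivalent_poles ::
    "complex \<Rightarrow> (complex \<Rightarrow> complex) \<Rightarrow> complex set \<Rightarrow> bool" where
  "complete_inequivalent_poles \<tau> f P \<longleftrightarrow>
     (\<forall>p\<in>P. is_pole f p) \<and>
     (\<forall>p\<in>P. \<forall>p'\<in>P. p \<noteq> p' \<longrightarrow> \<not> lattice_equiv \<tau> p p') \<and>
     (\<forall>z. is_pole f z \<longrightarrow> (\<exists>p\<in>P. lattice_equiv \<tau> z p))"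

definition only_simple_poles :: "(complex \<Rightarrow> complex) \<Rightarrow> bool" where
  "only_simple_poles f \<longleftrightarrow> (\<forall>z. is_pole f z \<longrightarrow> zorder f z = -1)"

end

(*
  Write u = exp (2 i z).  The product exp (i z) Q(1/u) Q(q u), where Q(x) is the product of the
  1 - q^n x over n >= 0, has the same two multipliers under z -> z + pi and z -> z + pi tau as
  theta_1 and simple zeros exactly on the lattice, so theta_1 divided by it is an entire elliptic
  function, hence a nonzero constant.  This locates the zeros of theta_1 and shows that
  K_y has residue 1 at 0 and no other poles up to equivalence, while it satisfies the same
  functional equations as f.  The difference of the two sides is therefore entire with multipliers
  1 and exp (-2 i y).  Multiplied by a suitable exponential it becomes bounded, so by Liouville it
  equals C exp (2 i m z), and C = 0 since exp (2 i y) is not an integral power of q.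
*)
theory Submission
  imports Defs
begin

subsection \<open>Quasi-elliptic functions\<close>

lemma translate_of_int_iff:
  fixes p :: complex
  assumes "\<And>z. R (z + p) \<longleftrightarrow> R z"
  shows "R (z + of_int m * p) \<longleftrightarrow> R z"
proof (induction m rule: int_induct[where k = 0])
  case (step1 i)
  then show ?case using assms[of "z + of_int i * p"] by (simp add: algebra_simps)
next
  case (step2 i)
  then show ?case using assms[of "z + of_int (i - 1) * p"] by (simp add: algebra_simps)
qed simp

text \<open>The predicate is left arbitrary because it is instantiated in two ways: by a bound on a
  modulus and by the property of being a pole.\<close>

lemma period_lattice_translate_iff:
  assumes "l \<in> period_lattice \<tau>"
    and "\<And>z. R (z + of_real pi) \<longleftrightarrow> R z"
    and "\<And>z. R (z + of_real pi * \<tau>) \<longleftrightarrow> R z"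
  shows "R (z + l) \<longleftrightarrow> R z"
proof -
  obtain m n :: int where "l = of_int m * of_real pi + of_int n * of_real pi * \<tau>"
    using assms(1) by (auto simp: period_lattice_def)
  then show ?thesis
    using translate_of_int_iff[of R "of_real pi", OF assms(2), of z m]
      translate_of_int_iff[of R "of_real pi * \<tau>", OF assms(3), of "z + of_int m * of_real pi" n]
    by (simp add: algebra_simps)
qed

text \<open>Since Im \<tau> > 0, \<open>z\<close> has real coordinates with respect to pi and pi
  \<tau>; subtracting their integer parts moves it into the fundamental parallelogram. The closed
  parallelogram is used because compactness is wanted.\<close>

lemma period_lattice_cases:
  assumes "Im \<tau> > 0"
  obtains l s t where "l \<in> period_lattice \<tau>" "s \<in> {0..1::real}" "t \<in> {0..1::real}"
    "z + l = of_real pi * of_real s + of_real pi * \<tau> * of_real t"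
proof -
  define y where "y = Im z / (pi * Im \<tau>)"
  define x where "x = (Re z - pi * Re \<tau> * y) / pi"
  have z: "z = of_real pi * of_real x + of_real pi * \<tau> * of_real y"
    using assms by (auto simp: complex_eq_iff x_def y_def field_simps)
  show thesis
  proof (rule that)
    show "of_int (- \<lfloor>x\<rfloor>) * of_real pi + of_int (- \<lfloor>y\<rfloor>) * of_real pi * \<tau> \<in> period_lattice \<tau>"
      unfolding period_lattice_def by blast
    show "frac x \<in> {0..1}" "frac y \<in> {0..1}"
      by (auto simp: frac_ge_0 less_imp_le[OF frac_lt_1])
    show "z + (of_int (- \<lfloor>x\<rfloor>) * of_real pi + of_int (- \<lfloor>y\<rfloor>) * of_real pi * \<tau>)
      = of_real pi * of_real (frac x) + of_real pi * \<tau> * of_real (frac y)"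
      by (subst (1) z) (simp add: frac_def algebra_simps)
  qed
qed

text \<open>A bound on one compact parallelogram spreads over the plane, so Liouville applies.
  Asking for periodicity of the modulus only admits unimodular multipliers, which remain after
  twisting by an exponential.\<close>

lemma entire_norm_doubly_periodic_const:
  assumes "Im \<tau> > 0" "h holomorphic_on UNIV"
    and "\<And>z. norm (h (z + of_real pi)) = norm (h z)"
    and "\<And>z. norm (h (z + of_real pi * \<tau>)) = norm (h z)"
  obtains K where "\<And>z. h z = K"
proof -
  define F where "F = (\<lambda>(s, t). of_real pi * of_real s + of_real pi * \<tau> * of_real t)
     ` ({0..1::real} \<times> {0..1::real})"
  have "compact F"
    unfolding F_def by (intro compact_continuous_image compact_Times)
      (auto simp: case_prod_unfold intro!: continuous_intros)
  then have "compact (h ` F)"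
    using assms(2) by (intro compact_continuous_image)
      (auto intro: continuous_on_subset holomorphic_on_imp_continuous_on)
  then obtain B where B: "\<And>w. w \<in> F \<Longrightarrow> norm (h w) \<le> B"
    by (force dest!: compact_imp_bounded simp: bounded_iff)
  have "norm (h z) \<le> B" for z
  proof -
    obtain l s t where l: "l \<in> period_lattice \<tau>" "s \<in> {0..1::real}" "t \<in> {0..1::real}"
      "z + l = of_real pi * of_real s + of_real pi * \<tau> * of_real t"
      using period_lattice_cases[OF assms(1)] by metis
    then have "z + l \<in> F" by (force simp: F_def)
    then have "norm (h (z + l)) \<le> B" by (rule B)
    moreover have "norm (h (z + l)) \<le> B \<longleftrightarrow> norm (h z) \<le> B"
      by (rule period_lattice_translate_iff[OF l(1)]) (auto simp: assms(3,4))
    ultimately show ?thesis by simp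
  qed
  then have "bounded (range h)" by (auto simp: bounded_iff)
  then show thesis
    using Liouville_theorem[OF assms(2)] that by (auto simp: constant_on_def)
qed

text \<open>Multiplying by a suitable \<open>exp (\<i> t z)\<close> with \<open>t\<close> real makes the modulus doubly periodic.\<close>

lemma entire_quasi_elliptic:
  assumes \<tau>: "Im \<tau> > 0" and g: "g holomorphic_on UNIV" and "c \<noteq> 0"
    and p1: "\<And>z. g (z + of_real pi) = g z"
    and p2: "\<And>z. g (z + of_real pi * \<tau>) = c * g z"
  obtains C and m :: int where "\<And>z. g z = C * exp (2 * \<i> * of_int m * z)"
    "C = 0 \<or> c = exp (2 * \<i> * of_int m * (of_real pi * \<tau>))"
proof -
  \<comment> \<open>Translation by pi \<tau> multiplies the modulus of exp (\<i> t z) by exp (- t pi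
    Im \<tau>); this \<open>t\<close> makes that factor the inverse of
    \<open>norm c\<close>.\<close>
  define t where "t = ln (norm c) / (pi * Im \<tau>)"
  define h where "h = (\<lambda>z. exp (\<i> * of_real t * z) * g z)"
  have "h holomorphic_on UNIV" unfolding h_def by (intro holomorphic_intros g)
  moreover have "norm (h (z + of_real pi)) = norm (h z)" for z
    by (simp add: h_def p1 norm_mult)
  moreover have "norm (h (z + of_real pi * \<tau>)) = norm (h z)" for z
  proof -
    have "t * (pi * Im \<tau>) = ln (norm c)" using \<tau> by (simp add: t_def)
    then have "exp (- (t * Im z) - t * (pi * Im \<tau>)) * norm c = exp (- (t * Im z))"
      using \<open>c \<noteq> 0\<close> by (simp add: exp_diff)
    moreover have "norm (exp (\<i> * of_real t * (z + of_real pi * \<tau>)))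
        = exp (- (t * Im z) - t * (pi * Im \<tau>))"
      by (simp add: algebra_simps)
    moreover have "norm (exp (\<i> * of_real t * z)) = exp (- (t * Im z))" by simp
    ultimately show ?thesis
      unfolding h_def p2 norm_mult by (simp add: mult.assoc[symmetric])
  qed
  ultimately obtain K where K: "\<And>z. h z = K"
    using entire_norm_doubly_periodic_const[OF \<tau>] by metis
  have gK: "g z = K * exp (- (\<i> * of_real t * z))" for z
    using K[of z] by (simp add: h_def exp_minus field_simps)
  show thesis
  proof (cases "K = 0")
    case True
    then show thesis using gK that[of 0 0] by simp
  next
    case False
    \<comment> \<open>For nonzero \<open>K\<close>, the exact period pi of \<open>g\<close>, and not
      just of its modulus, forces \<open>- t\<close> to be an even integer.\<close>
    have "exp (- (\<i> * of_real t * of_real pi)) = 1"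
      using gK[of 0] gK[of "of_real pi"] p1[of 0] False by simp
    then obtain m :: int where "- (t * pi) = of_int (2 * m) * pi"
      by (auto simp: exp_eq_1)
    then have "- t * pi = of_int (2 * m) * pi" by simp
    then have t: "- t = of_int (2 * m)" by (simp only: mult_cancel_right) simp
    have e: "- (\<i> * of_real t * z) = 2 * \<i> * of_int m * z" for z
    proof -
      have "of_real (- t) = (of_int (2 * m) :: complex)" by (subst t) simp
      then have "- of_real t = 2 * (of_int m :: complex)" by simp
      then show ?thesis by (metis (no_types) mult.assoc mult.commute mult_minus_right)
    qed
    show thesis
    proof (rule that)
      show "g z = K * exp (2 * \<i> * of_int m * z)" for z using gK[of z] e[of z] by simp
      have "c = exp (- (\<i> * of_real t * (of_real pi * \<tau>)))"
        using gK[of 0] gK[of "of_real pi * \<tau>"] p2[of 0] False by simp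
      then show "K = 0 \<or> c = exp (2 * \<i> * of_int m * (of_real pi * \<tau>))"
        using e by simp
    qed
  qed
qed

section \<open>Removable singularities and the passage to meromorphic functions\<close>

lemma not_is_pole_if_times_tendsto_0:
  assumes "g meromorphic_on {z}" and lim: "((\<lambda>w. (w - z) * g w) \<longlongrightarrow> 0) (at z)"
  shows "\<not> is_pole g z"
proof -
  obtain r where r: "r > 0" "g holomorphic_on ball z r - {z}"
    using meromorphic_on_isolated_singularity[OF assms(1)]
    by (auto simp: isolated_singularity_at_def intro: analytic_imp_holomorphic)
  \<comment> \<open>Riemann's theorem on removable singularities; continuity of the extension then
    gives \<open>g\<close> a finite limit at \<open>z\<close>.\<close>
  then obtain k where k: "k holomorphic_on ball z r" "\<And>w. w \<in> ball z r - {z} \<Longrightarrow> k w = g w"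
    using holomorphic_on_extend_lim[of g "ball z r" z] lim by auto
  have "isCont k z"
    using holomorphic_on_imp_continuous_on[OF k(1)] r(1) by (simp add: continuous_on_eq_continuous_at)
  moreover have "eventually (\<lambda>w. k w = g w) (at z)"
    using eventually_at_in_open[of "ball z r" z] r(1) by (auto elim!: eventually_mono intro: k(2))
  ultimately have "(g \<longlongrightarrow> k z) (at z)"
    by (auto simp: isCont_def intro: Lim_transform_eventually)
  then show ?thesis
    unfolding is_pole_def using not_tendsto_and_filterlim_at_infinity at_neq_bot by blast
qed

text \<open>The equation may fail on a sparse set, but it holds on a punctured neighbourhood of
  every point, and being a pole depends on nothing more.\<close>

lemma is_pole_translate_iff:
  fixes g :: "complex \<Rightarrow> complex"
  assumes "\<forall>\<^sub>\<approx>z. g (z + p) = c * g z" "c \<noteq> 0"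
  shows "is_pole g (z + p) \<longleftrightarrow> is_pole g z"
proof -
  have "is_pole g (z + p) \<longleftrightarrow> is_pole (\<lambda>w. g (w + p)) z"
    using is_pole_shift_iff[of g p z] by (simp add: o_def add.commute)
  also have "\<dots> \<longleftrightarrow> is_pole (\<lambda>w. c * g w) z"
    using assms(1) by (intro is_pole_cong) (auto simp: eventually_cosparse_open_eq)
  also have "\<dots> \<longleftrightarrow> is_pole g z"
    using tendsto_mult_filterlim_at_infinity[of "\<lambda>_. c" c "at z" g]
      tendsto_mult_filterlim_at_infinity[of "\<lambda>_. inverse c" "inverse c" "at z" "\<lambda>w. c * g w"] \<open>c \<noteq> 0\<close>
    by (auto simp: is_pole_def field_simps)
  finally show ?thesis .
qed

text \<open>Removability is assumed at one representative of each lattice class; the two equations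
  carry it to the whole class. Filling in the singularities leaves an entire function, and the
  conclusion about \<open>g\<close> itself can only hold off a sparse set.\<close>

lemma meromorphic_quasi_elliptic:
  assumes \<tau>: "Im \<tau> > 0" and g: "g meromorphic_on UNIV" and "c \<noteq> 0"
    and p1: "\<forall>\<^sub>\<approx>z. g (z + of_real pi) = g z"
    and p2: "\<forall>\<^sub>\<approx>z. g (z + of_real pi * \<tau>) = c * g z"
    and lim: "\<And>z. \<exists>l\<in>period_lattice \<tau>. ((\<lambda>w. (w - (z + l)) * g w) \<longlongrightarrow> 0) (at (z + l))"
  obtains C and m :: int where "\<forall>\<^sub>\<approx>z. g z = C * exp (2 * \<i> * of_int m * z)"
    "C = 0 \<or> c = exp (2 * \<i> * of_int m * (of_real pi * \<tau>))"
proof -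
  have mero: "g meromorphic_on {z}" for z
    using g by (rule meromorphic_on_subset) simp
  have no_pole: "\<not> is_pole g z" for z
  proof -
    obtain l where l: "l \<in> period_lattice \<tau>" "((\<lambda>w. (w - (z + l)) * g w) \<longlongrightarrow> 0) (at (z + l))"
      using lim by blast
    have "\<not> is_pole g (z + l)"
      using not_is_pole_if_times_tendsto_0[OF mero l(2)] .
    then show ?thesis
      using period_lattice_translate_iff[OF l(1), of "is_pole g" z]
        is_pole_translate_iff[of g "of_real pi" 1] p1 is_pole_translate_iff[OF p2 \<open>c \<noteq> 0\<close>]
      by simp
  qed
  define G where "G = remove_sings g"
  have G_lim: "(g \<longlongrightarrow> G z) (at z)" for z
  proof -
    obtain L where "(g \<longlongrightarrow> L) (at z)"
      using meromorphic_on_not_essential[OF mero, of z] no_pole[of z]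
      by (auto simp: not_essential_def)
    moreover from this have "G z = L" unfolding G_def by (rule remove_sings_eqI)
    ultimately show ?thesis by simp
  qed
  have "G analytic_on {z}" for z
    unfolding G_def
    using remove_sings_analytic_at[of g z] meromorphic_on_isolated_singularity[OF mero] G_lim
    by blast
  then have holo: "G holomorphic_on UNIV"
    using analytic_on_analytic_at[of G UNIV] analytic_imp_holomorphic by blast
  \<comment> \<open>Near each point the equation for \<open>g\<close> holds in a punctured
    neighbourhood, so taking limits gives it for \<open>G\<close> everywhere.\<close>
  have G_translate: "G (z + p) = d * G z" if p: "\<forall>\<^sub>\<approx>z. g (z + p) = d * g z" for z p d
  proof (rule tendsto_unique)
    show "at z \<noteq> bot" by simp
    show "((\<lambda>w. g (w + p)) \<longlongrightarrow> G (z + p)) (at z)"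
      using LIM_offset[OF G_lim[of "z + p"], of p] by simp
    have "((\<lambda>w. d * g w) \<longlongrightarrow> d * G z) (at z)"
      by (intro tendsto_intros G_lim)
    moreover have "\<forall>\<^sub>\<approx>w. d * g w = g (w + p)"
      using p by eventually_elim simp
    then have "eventually (\<lambda>w. d * g w = g (w + p)) (at z)"
      by (simp add: eventually_cosparse_open_eq)
    ultimately show "((\<lambda>w. g (w + p)) \<longlongrightarrow> d * G z) (at z)"
      by (rule Lim_transform_eventually)
  qed
  obtain C and m :: int where Cm: "\<And>z. G z = C * exp (2 * \<i> * of_int m * z)"
    "C = 0 \<or> c = exp (2 * \<i> * of_int m * (of_real pi * \<tau>))"
  proof (rule entire_quasi_elliptic[OF \<tau> holo \<open>c \<noteq> 0\<close>])
    show "G (z + of_real pi) = G z" for z using G_translate[of "of_real pi" 1 z] p1 by simp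
    show "G (z + of_real pi * \<tau>) = c * G z" for z by (rule G_translate[OF p2])
  qed blast
  have "\<forall>\<^sub>\<approx>z. G z = g z"
    unfolding G_def by (rule eventually_remove_sings_eq[OF g])
  then have "\<forall>\<^sub>\<approx>z. g z = C * exp (2 * \<i> * of_int m * z)"
    by eventually_elim (simp flip: Cm(1))
  then show thesis using that Cm(2) by blast
qed

subsection \<open>Euler's product as an entire power series\<close>

text \<open>Coefficient ratios tending to 0 mean an infinite radius of convergence. This serves both
  Euler's series and the theta series.\<close>

lemma
  fixes a r :: "nat \<Rightarrow> complex"
  assumes rec: "\<And>n. a (Suc n) = r n * a n" and "r \<longlonglongrightarrow> 0"
  shows summable_ratio_tendsto_0: "summable (\<lambda>n. a n * x ^ n)"
    and holomorphic_ratio_tendsto_0: "(\<lambda>x. \<Sum>n. a n * x ^ n) holomorphic_on UNIV"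
proof -
  have summ: "summable (\<lambda>n. a n * x ^ n)" for x
  proof -
    have "(\<lambda>n. norm (r n * x)) \<longlonglongrightarrow> 0"
      using assms(2) by (intro tendsto_norm_zero tendsto_mult_left_zero)
    then have "eventually (\<lambda>n. norm (r n * x) < 1/2) sequentially"
      by (rule order_tendstoD) simp
    then obtain N where N: "\<And>n. n \<ge> N \<Longrightarrow> norm (r n * x) < 1/2"
      by (auto simp: eventually_at_top_linorder)
    show ?thesis
    proof (rule summable_ratio_test[of "1/2" N])
      fix n assume "n \<ge> N"
      have "norm (a (Suc n) * x ^ Suc n) = norm (r n * x) * norm (a n * x ^ n)"
        by (simp add: rec norm_mult norm_power mult_ac)
      also have "\<dots> \<le> 1/2 * norm (a n * x ^ n)"
        using N[OF \<open>n \<ge> N\<close>] by (intro mult_right_mono) auto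
      finally show "norm (a (Suc n) * x ^ Suc n) \<le> 1/2 * norm (a n * x ^ n)" .
    qed simp
  qed
  show "summable (\<lambda>n. a n * x ^ n)" by (rule summ)
  have "(\<lambda>x. \<Sum>n. a n * x ^ n) holomorphic_on ball 0 R" for R
    by (rule power_series_holomorphic[where a = a]) (use summ in \<open>auto intro: summable_sums\<close>)
  then have "(\<lambda>x. \<Sum>n. a n * x ^ n) field_differentiable at x" for x
    using holomorphic_on_imp_differentiable_at[OF _ open_ball, of _ 0 "norm x + 1" x] by simp
  then show "(\<lambda>x. \<Sum>n. a n * x ^ n) holomorphic_on UNIV"
    by (simp add: holomorphic_on_def field_differentiable_at_within)
qed

text \<open>In closed form these are Euler's coefficients (-1)^n q^(n(n-1)/2) / ((1-q)...(1-q^n)).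
  The recursive form exposes the ratio on which convergence and the functional equation
  rest.\<close>

primrec qpoch_coeff :: "complex \<Rightarrow> nat \<Rightarrow> complex" where
  "qpoch_coeff q 0 = 1"
| "qpoch_coeff q (Suc n) = - (q ^ n / (1 - q ^ Suc n)) * qpoch_coeff q n"

text \<open>Euler's expansion of the infinite product of the \<open>1 - q\<^sup>n x\<close>; as a power series
  it is entire for free, and its zeros can be read off from the functional equation.\<close>

definition qpoch :: "complex \<Rightarrow> complex \<Rightarrow> complex" where
  "qpoch q x = (\<Sum>n. qpoch_coeff q n * x ^ n)"

lemma qpoch_ratio_tendsto_0:
  fixes q :: complex
  assumes "norm q < 1"
  shows "(\<lambda>n. - (q ^ n / (1 - q ^ Suc n))) \<longlonglongrightarrow> 0"
proof -
  have "(\<lambda>n. q ^ n) \<longlonglongrightarrow> 0" using assms by (rule LIMSEQ_power_zero)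
  moreover from this have "(\<lambda>n. q ^ Suc n) \<longlonglongrightarrow> 0" by (rule LIMSEQ_Suc)
  ultimately have "(\<lambda>n. - (q ^ n / (1 - q ^ Suc n))) \<longlonglongrightarrow> - (0 / (1 - 0))"
    by (intro tendsto_intros) (use assms in simp_all)
  then show ?thesis by simp
qed

lemma holomorphic_qpoch: "norm q < 1 \<Longrightarrow> qpoch q holomorphic_on UNIV"
  unfolding qpoch_def[abs_def]
  by (rule holomorphic_ratio_tendsto_0[OF _ qpoch_ratio_tendsto_0]) simp_all

lemma qpoch_0 [simp]: "qpoch q 0 = 1"
  by (simp add: qpoch_def)

lemma one_minus_power_neq_0:
  fixes q :: complex
  assumes "norm q < 1" shows "1 - q ^ Suc n \<noteq> 0"
proof
  assume "1 - q ^ Suc n = 0"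
  then have "norm (q ^ Suc n) = 1" by simp
  moreover have "norm q ^ Suc n < 1"
    using power_Suc_less_one[OF _ assms, of n] by (cases "q = 0") auto
  ultimately show False by (simp only: norm_power)
qed

text \<open>In the difference of the two series the constant terms cancel, and multiplying the
  coefficient of index n+1 by 1 - q^(n+1) clears the denominator in its recursion.\<close>

lemma qpoch_rec:
  assumes q: "norm q < 1"
  shows "qpoch q x = (1 - x) * qpoch q (q * x)"
proof -
  have summ: "summable (\<lambda>n. qpoch_coeff q n * x ^ n)" for x
    by (rule summable_ratio_tendsto_0[OF _ qpoch_ratio_tendsto_0[OF q]]) simp
  have "qpoch q x - qpoch q (q * x)
      = (\<Sum>n. qpoch_coeff q n * x ^ n - qpoch_coeff q n * (q * x) ^ n)"
    unfolding qpoch_def by (rule suminf_diff[OF summ summ])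
  also have "\<dots> = (\<Sum>n. qpoch_coeff q (Suc n) * x ^ Suc n - qpoch_coeff q (Suc n) * (q * x) ^ Suc n)"
    using suminf_split_head[OF summable_diff[OF summ summ], of x "q * x"] by simp
  also have "\<dots> = (\<Sum>n. - x * (qpoch_coeff q n * (q * x) ^ n))"
  proof (rule suminf_cong)
    fix n
    have nz: "1 - q ^ Suc n \<noteq> 0" using q by (rule one_minus_power_neq_0)
    have "qpoch_coeff q (Suc n) * x ^ Suc n - qpoch_coeff q (Suc n) * (q * x) ^ Suc n
      = (qpoch_coeff q (Suc n) * (1 - q ^ Suc n)) * x ^ Suc n"
      by (simp only: power_mult_distrib) (simp add: algebra_simps del: qpoch_coeff.simps)
    also have "qpoch_coeff q (Suc n) * (1 - q ^ Suc n) = - (q ^ n) * qpoch_coeff q n"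
      unfolding qpoch_coeff.simps using nz by (simp del: power_Suc)
    also have "- (q ^ n) * qpoch_coeff q n * x ^ Suc n = - x * (qpoch_coeff q n * (q * x) ^ n)"
      by (simp add: power_mult_distrib mult_ac)
    finally show "qpoch_coeff q (Suc n) * x ^ Suc n - qpoch_coeff q (Suc n) * (q * x) ^ Suc n
      = - x * (qpoch_coeff q n * (q * x) ^ n)" .
  qed
  also have "\<dots> = - x * qpoch q (q * x)"
    unfolding qpoch_def by (rule suminf_mult[OF summ])
  finally show ?thesis by (simp add: algebra_simps)
qed

text \<open>Iterating the recursion splits off the factors 1 - q^k x for k < n. The remaining value
  at q^n x tends to \<open>qpoch q 0 = 1\<close>, hence is nonzero for some n, so every zero comes
  from a split-off factor.\<close>

lemma qpoch_eq_0_iff: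
  assumes q: "norm q < 1"
  shows "qpoch q x = 0 \<longleftrightarrow> (\<exists>n. q ^ n * x = 1)"
proof -
  have step: "qpoch q x = 0 \<longleftrightarrow> (\<exists>k<n. q ^ k * x = 1) \<or> qpoch q (q ^ n * x) = 0" for n
  proof (induction n)
    case (Suc n)
    have "qpoch q (q ^ n * x) = 0 \<longleftrightarrow> q ^ n * x = 1 \<or> qpoch q (q ^ Suc n * x) = 0"
      using qpoch_rec[OF q, of "q ^ n * x"] by (auto simp: mult.assoc)
    then show ?case using Suc.IH by (auto simp: less_Suc_eq)
  qed simp
  have "(\<lambda>n. q ^ n * x) \<longlonglongrightarrow> 0"
    by (intro tendsto_mult_left_zero LIMSEQ_power_zero q)
  moreover have "isCont (qpoch q) 0"
    using holomorphic_on_imp_continuous_on[OF holomorphic_qpoch[OF q]]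
    by (simp add: continuous_on_eq_continuous_at)
  ultimately have "(\<lambda>n. qpoch q (q ^ n * x)) \<longlonglongrightarrow> qpoch q 0"
    by (metis isCont_tendsto_compose)
  then have "eventually (\<lambda>n. qpoch q (q ^ n * x) \<noteq> 0) sequentially"
    by (rule tendsto_imp_eventually_ne) simp
  then obtain n where "qpoch q (q ^ n * x) \<noteq> 0"
    by (auto simp: eventually_at_top_linorder)
  then have "qpoch q x = 0 \<Longrightarrow> \<exists>n. q ^ n * x = 1" using step[of n] by auto
  moreover have "q ^ n * x = 1 \<Longrightarrow> qpoch q x = 0" for n using step[of "Suc n"] by auto
  ultimately show ?thesis by blast
qed

subsection \<open>Functional equations of the theta function\<close>

definition theta_coeff :: "complex \<Rightarrow> nat \<Rightarrow> complex" where
  "theta_coeff \<tau> n = (-1) ^ n * qpow \<tau> ((2 * real n + 1)\<^sup>2 / 8)"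

text \<open>A partial theta function: the positive frequencies of the theta series, with exp (\<i>
  z) taken out, as a power series in x = exp (2 \<i> z).\<close>

definition half_theta :: "complex \<Rightarrow> complex \<Rightarrow> complex" where
  "half_theta \<tau> x = (\<Sum>n. theta_coeff \<tau> n * x ^ n)"

lemma qpow_add: "qpow \<tau> (s + t) = qpow \<tau> s * qpow \<tau> t"
  by (simp add: qpow_def algebra_simps flip: exp_add)

lemma qpow_0 [simp]: "qpow \<tau> 0 = 1" by (simp add: qpow_def)

lemma qpow_neq_0 [simp]: "qpow \<tau> s \<noteq> 0"
  by (simp add: qpow_def)

lemma qpow_of_nat: "qpow \<tau> (of_nat n) = qpow \<tau> 1 ^ n"
  by (induction n) (simp_all add: qpow_add)

lemma norm_qpow_less_1: "Im \<tau> > 0 \<Longrightarrow> s > 0 \<Longrightarrow> norm (qpow \<tau> s) < 1"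
  by (simp add: qpow_def)

text \<open>(2n+3)^2 - (2n+1)^2 = 8(n+1), so the quotient of consecutive coefficients is an integral
  power of q up to sign.\<close>

lemma theta_coeff_Suc: "theta_coeff \<tau> (Suc n) = - (qpow \<tau> 1 ^ Suc n) * theta_coeff \<tau> n"
proof -
  have "(2 * real (Suc n) + 1)\<^sup>2 / 8 = real (Suc n) + (2 * real n + 1)\<^sup>2 / 8"
    by (simp add: power2_eq_square field_simps)
  then show ?thesis
    by (simp only: theta_coeff_def qpow_add qpow_of_nat) simp
qed

lemma theta_ratio_tendsto_0: "Im \<tau> > 0 \<Longrightarrow> (\<lambda>n. - (qpow \<tau> 1 ^ Suc n)) \<longlonglongrightarrow> 0"
  using tendsto_minus[OF LIMSEQ_Suc[OF LIMSEQ_power_zero[OF norm_qpow_less_1[of \<tau> 1]]]] by simp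

lemma summable_half_theta: "Im \<tau> > 0 \<Longrightarrow> summable (\<lambda>n. theta_coeff \<tau> n * x ^ n)"
  using theta_coeff_Suc theta_ratio_tendsto_0 by (rule summable_ratio_tendsto_0)

lemma holomorphic_half_theta: "Im \<tau> > 0 \<Longrightarrow> half_theta \<tau> holomorphic_on UNIV"
  unfolding half_theta_def[abs_def]
  using theta_coeff_Suc theta_ratio_tendsto_0 by (rule holomorphic_ratio_tendsto_0)

lemma half_theta_0: "half_theta \<tau> 0 = qpow \<tau> (1/8)"
  by (simp add: half_theta_def theta_coeff_def)

text \<open>An index shift that leaves the term n = 0 over. This inhomogeneous term enters the two
  halves of \<open>theta1\<close> with opposite signs and cancels there.\<close>

lemma half_theta_rec:
  assumes "Im \<tau> > 0"
  shows "half_theta \<tau> x + qpow \<tau> 1 * x * half_theta \<tau> (qpow \<tau> 1 * x) = qpow \<tau> (1/8)"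
proof -
  note summ = summable_half_theta[OF assms]
  have "half_theta \<tau> x - qpow \<tau> (1/8) = (\<Sum>n. theta_coeff \<tau> (Suc n) * x ^ Suc n)"
    using suminf_split_head[OF summ, of x] by (simp add: half_theta_def theta_coeff_def)
  also have "\<dots> = (\<Sum>n. - (qpow \<tau> 1 * x) * (theta_coeff \<tau> n * (qpow \<tau> 1 * x) ^ n))"
    by (intro suminf_cong) (simp add: theta_coeff_Suc power_mult_distrib mult_ac)
  also have "\<dots> = - (qpow \<tau> 1 * x) * half_theta \<tau> (qpow \<tau> 1 * x)"
    unfolding half_theta_def by (rule suminf_mult[OF summ])
  finally show ?thesis by (simp add: algebra_simps)
qed

text \<open>Euler's formula splits each sine into a power of exp (2 \<i> z) and its mirror image;
  the factor 2 in front of the series turns 1/(2 \<i>) into - \<i>.\<close>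

lemma theta1_eq_half_theta:
  assumes "Im \<tau> > 0"
  shows "theta1 \<tau> z = - \<i> * (exp (\<i> * z) * half_theta \<tau> (exp (2 * \<i> * z))
    - exp (- \<i> * z) * half_theta \<tau> (exp (- 2 * \<i> * z)))"
proof -
  have sums: "(\<lambda>n. theta_coeff \<tau> n * x ^ n) sums half_theta \<tau> x" for x
    unfolding half_theta_def by (rule summable_sums[OF summable_half_theta[OF assms]])
  define E where "E = (\<lambda>n. - \<i> / 2 * (exp (\<i> * z) * (theta_coeff \<tau> n * exp (2 * \<i> * z) ^ n)
    - exp (- \<i> * z) * (theta_coeff \<tau> n * exp (- 2 * \<i> * z) ^ n)))"
  have "E sums (- \<i> / 2 * (exp (\<i> * z) * half_theta \<tau> (exp (2 * \<i> * z))
    - exp (- \<i> * z) * half_theta \<tau> (exp (- 2 * \<i> * z))))"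
    unfolding E_def by (intro sums_mult sums_diff sums)
  moreover have "E = (\<lambda>n. (-1) ^ n * qpow \<tau> ((2 * real n + 1)\<^sup>2 / 8) * sin ((2 * of_nat n + 1) * z))"
  proof
    fix n
    have "exp (\<i> * z) * exp (2 * \<i> * z) ^ n = exp (\<i> * ((2 * of_nat n + 1) * z))"
      by (simp add: algebra_simps flip: exp_of_nat_mult exp_add)
    moreover have "exp (- \<i> * z) * exp (- 2 * \<i> * z) ^ n = exp (- (\<i> * ((2 * of_nat n + 1) * z)))"
      by (simp add: algebra_simps flip: exp_of_nat_mult exp_add)
    moreover have "E n = theta_coeff \<tau> n * (- \<i> / 2 * (exp (\<i> * z) * exp (2 * \<i> * z) ^ n
       - exp (- \<i> * z) * exp (- 2 * \<i> * z) ^ n))"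
      by (simp add: E_def algebra_simps)
    moreover have "sin w = - \<i> / 2 * (exp (\<i> * w) - exp (- (\<i> * w)))" for w
      by (simp add: sin_exp_eq field_simps)
    ultimately show "E n = (-1) ^ n * qpow \<tau> ((2 * real n + 1)\<^sup>2 / 8) * sin ((2 * of_nat n + 1) * z)"
      by (simp add: theta_coeff_def)
  qed
  ultimately have "(\<Sum>n. (-1) ^ n * qpow \<tau> ((2 * real n + 1)\<^sup>2 / 8) * sin ((2 * of_nat n + 1) * z))
    = - \<i> / 2 * (exp (\<i> * z) * half_theta \<tau> (exp (2 * \<i> * z))
      - exp (- \<i> * z) * half_theta \<tau> (exp (- 2 * \<i> * z)))"
    by (simp only: sums_iff)
  then show ?thesis
    unfolding theta1_def by (simp only:) simp
qed

lemma holomorphic_theta1: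
  assumes "Im \<tau> > 0" shows "theta1 \<tau> holomorphic_on UNIV"
proof -
  have "(\<lambda>z. half_theta \<tau> (exp (c * z))) holomorphic_on UNIV" for c
    using holomorphic_on_compose_gen[OF _ holomorphic_half_theta[OF assms], of "\<lambda>z. exp (c * z)" UNIV]
    by (simp add: o_def holomorphic_intros)
  note [holomorphic_intros] = this
  show ?thesis
    unfolding theta1_eq_half_theta[OF assms, abs_def] by (intro holomorphic_intros)
qed

lemma theta1_0 [simp]: "theta1 \<tau> 0 = 0"
  by (simp add: theta1_def)

lemma exp_i_pi_translate:
  "exp (\<i> * (z + of_real pi)) = - exp (\<i> * z)"
  "exp (- \<i> * (z + of_real pi)) = - exp (- \<i> * z)"
  "exp (2 * \<i> * (z + of_real pi)) = exp (2 * \<i> * z)"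
  "exp (- 2 * \<i> * (z + of_real pi)) = exp (- 2 * \<i> * z)"
  by (simp_all add: exp_add exp_diff ring_distribs exp_minus mult_ac exp_double)

lemma theta1_add_pi:
  assumes "Im \<tau> > 0"
  shows "theta1 \<tau> (z + of_real pi) = - theta1 \<tau> z"
  unfolding theta1_eq_half_theta[OF assms] exp_i_pi_translate by (simp add: algebra_simps)

lemma exp_i_pi_tau_translate:
  "exp (\<i> * (z + of_real pi * \<tau>)) = qpow \<tau> (1/2) * exp (\<i> * z)"
  "exp (- \<i> * (z + of_real pi * \<tau>)) = exp (- \<i> * z) / qpow \<tau> (1/2)"
  "exp (2 * \<i> * (z + of_real pi * \<tau>)) = qpow \<tau> 1 * exp (2 * \<i> * z)"
  "exp (- 2 * \<i> * (z + of_real pi * \<tau>)) = exp (- 2 * \<i> * z) / qpow \<tau> 1"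
  by (simp_all add: qpow_def algebra_simps flip: exp_add exp_diff)

lemma theta1_add_pi_tau:
  assumes "Im \<tau> > 0"
  shows "theta1 \<tau> (z + of_real pi * \<tau>) = - (exp (- 2 * \<i> * z) / qpow \<tau> (1/2)) * theta1 \<tau> z"
proof -
  define s where "s = exp (\<i> * z)"
  define p where "p = qpow \<tau> (1/2)"
  define D where "D = half_theta \<tau>"
  have [simp]: "s \<noteq> 0" "p \<noteq> 0" by (auto simp: s_def p_def)
  have q: "qpow \<tau> 1 = p\<^sup>2" using qpow_add[of \<tau> "1/2" "1/2"] by (simp add: p_def power2_eq_square)
  have e: "exp (- \<i> * z) = 1 / s" "exp (2 * \<i> * z) = s\<^sup>2" "exp (- 2 * \<i> * z) = 1 / s\<^sup>2"
    by (simp_all add: s_def exp_minus field_simps flip: exp_double)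
  have 1: "D (s\<^sup>2) + p\<^sup>2 * s\<^sup>2 * D (p\<^sup>2 * s\<^sup>2) = qpow \<tau> (1/8)"
    using half_theta_rec[OF assms, of "s\<^sup>2"] by (simp add: q D_def)
  \<comment> \<open>The recursion is applied at 1/(p^2 s^2), chosen so that multiplication by q =
    p^2 returns 1/s^2.\<close>
  have 2: "D (1 / s\<^sup>2 / p\<^sup>2) + D (1 / s\<^sup>2) / s\<^sup>2 = qpow \<tau> (1/8)"
    using half_theta_rec[OF assms, of "1 / s\<^sup>2 / p\<^sup>2"] by (simp add: q D_def)
  from 1 have 1: "D (p\<^sup>2 * s\<^sup>2) = (qpow \<tau> (1/8) - D (s\<^sup>2)) / (p\<^sup>2 * s\<^sup>2)"
    by (simp add: field_simps)
  from 2 have 2: "D (1 / s\<^sup>2 / p\<^sup>2) = qpow \<tau> (1/8) - D (1 / s\<^sup>2) / s\<^sup>2"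
    by (simp add: field_simps)
  show ?thesis
    unfolding theta1_eq_half_theta[OF assms] exp_i_pi_tau_translate e q
    unfolding s_def[symmetric] p_def[symmetric] D_def[symmetric] 1 2
    by (simp add: field_simps power2_eq_square)
qed

text \<open>If \<open>theta1\<close> vanished, the entire function \<open>x D(x) = D(1/x)\<close>, with \<open>D = half_theta \<tau>\<close>, would
  tend to \<open>D(0) \<noteq> 0\<close> at infinity, hence be constant although it is 0 at 0.\<close>

lemma theta1_not_identically_0:
  assumes "Im \<tau> > 0"
  obtains z where "theta1 \<tau> z \<noteq> 0"
proof (rule ccontr)
  assume "\<not> thesis"
  then have zero: "theta1 \<tau> z = 0" for z using that by blast
  define D where "D = half_theta \<tau>"
  have holo: "D holomorphic_on UNIV" unfolding D_def by (rule holomorphic_half_theta[OF assms])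
  have eq: "x * D x = D (inverse x)" if "x \<noteq> 0" for x
  proof -
    \<comment> \<open>A logarithm writes any nonzero \<open>x\<close> as exp (2 \<i> z), so that the
      vanishing of \<open>theta1\<close> becomes a relation in \<open>x\<close>.\<close>
    define z where "z = ln x / (2 * \<i>)"
    define s where "s = exp (\<i> * z)"
    have x: "exp (2 * \<i> * z) = x" using that by (simp add: z_def)
    have s2: "x = s\<^sup>2" unfolding s_def x[symmetric] by (simp flip: exp_double add: mult_ac)
    have "s \<noteq> 0" by (simp add: s_def)
    have e: "exp (- \<i> * z) = 1 / s" "exp (- 2 * \<i> * z) = inverse x"
      by (simp_all add: s_def exp_minus field_simps flip: x)
    have "s * D x - D (inverse x) / s = 0"
      using zero[of z] unfolding theta1_eq_half_theta[OF assms] e x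
      by (simp add: D_def s_def)
    then show ?thesis using \<open>s \<noteq> 0\<close> by (simp add: s2 field_simps power2_eq_square)
  qed
  have "isCont D 0"
    using holomorphic_on_imp_continuous_on[OF holo] by (simp add: continuous_on_eq_continuous_at)
  then have "((\<lambda>x. D (inverse x)) \<longlongrightarrow> D 0) at_infinity"
    by (rule isCont_tendsto_compose) (rule tendsto_inverse_0)
  moreover have "eventually (\<lambda>x. D (inverse x) = x * D x) at_infinity"
    unfolding eventually_at_infinity
  proof (intro exI[of _ 1] allI impI)
    fix x :: complex assume "1 \<le> norm x"
    then have "x \<noteq> 0" by auto
    then show "D (inverse x) = x * D x" using eq by simp
  qed
  ultimately have "((\<lambda>x. x * D x) \<longlongrightarrow> D 0) at_infinity"
    by (rule Lim_transform_eventually)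
  then have "0 * D 0 = D 0"
    by (intro Liouville_weak[of "\<lambda>x. x * D x"] holomorphic_intros holo)
  then show False by (simp add: D_def half_theta_0)
qed

subsection \<open>Zeros of the theta function\<close>

text \<open>Up to a constant factor, the product side of Jacobi's triple product identity. The extra
  q in the last argument makes that product start at n = 1, so that no factor occurs twice and the
  zeros are simple.\<close>

definition theta_prod :: "complex \<Rightarrow> complex \<Rightarrow> complex" where
  "theta_prod \<tau> z = exp (\<i> * z) * qpoch (qpow \<tau> 1) (exp (- 2 * \<i> * z))
     * qpoch (qpow \<tau> 1) (qpow \<tau> 1 * exp (2 * \<i> * z))"

lemma holomorphic_theta_prod:
  assumes "Im \<tau> > 0" shows "theta_prod \<tau> holomorphic_on UNIV"
proof -
  have "(\<lambda>z. qpoch (qpow \<tau> 1) (d * exp (c * z))) holomorphic_on UNIV" for d c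
    using holomorphic_on_compose_gen[OF _ holomorphic_qpoch[OF norm_qpow_less_1[OF assms zero_less_one]],
        of "\<lambda>z. d * exp (c * z)" UNIV]
    by (simp add: o_def holomorphic_intros)
  note [holomorphic_intros] = this this[of 1, unfolded mult_1]
  show ?thesis
    unfolding theta_prod_def[abs_def] by (intro holomorphic_intros)
qed

lemma theta_prod_add_pi: "theta_prod \<tau> (z + of_real pi) = - theta_prod \<tau> z"
  unfolding theta_prod_def exp_i_pi_translate by simp

lemma theta_prod_add_pi_tau:
  assumes "Im \<tau> > 0"
  shows "theta_prod \<tau> (z + of_real pi * \<tau>) = - (exp (- 2 * \<i> * z) / qpow \<tau> (1/2)) * theta_prod \<tau> z"
proof -
  define s where "s = exp (\<i> * z)"
  define p where "p = qpow \<tau> (1/2)"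
  define Q where "Q = qpoch (p\<^sup>2)"
  have [simp]: "s \<noteq> 0" "p \<noteq> 0" by (auto simp: s_def p_def)
  have q: "qpow \<tau> 1 = p\<^sup>2" using qpow_add[of \<tau> "1/2" "1/2"] by (simp add: p_def power2_eq_square)
  have e: "exp (2 * \<i> * z) = s\<^sup>2" "exp (- 2 * \<i> * z) = 1 / s\<^sup>2"
    by (simp_all add: s_def exp_minus field_simps flip: exp_double)
  have p1: "norm (p\<^sup>2) < 1" using norm_qpow_less_1[OF assms, of 1] by (simp add: q)
  define A where "A = Q (1 / s\<^sup>2)"
  define B where "B = Q (p\<^sup>2 * (p\<^sup>2 * s\<^sup>2))"
  have "p\<^sup>2 * (1 / s\<^sup>2 / p\<^sup>2) = 1 / s\<^sup>2" by simp
  \<comment> \<open>Translation adds the factor 1 - 1/(p^2 s^2) to one product and removes 1 - p^2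
    s^2 from the other. Their quotient is -1/(p^2 s^2), and the prefactor contributes p.\<close>
  then have 1: "Q (1 / s\<^sup>2 / p\<^sup>2) = (1 - 1 / s\<^sup>2 / p\<^sup>2) * A"
    using qpoch_rec[OF p1, of "1 / s\<^sup>2 / p\<^sup>2"] unfolding A_def Q_def by (simp only:)
  have 2: "Q (p\<^sup>2 * s\<^sup>2) = (1 - p\<^sup>2 * s\<^sup>2) * B"
    unfolding B_def Q_def by (rule qpoch_rec[OF p1])
  show ?thesis
    unfolding theta_prod_def exp_i_pi_tau_translate e q
    unfolding s_def[symmetric] p_def[symmetric] Q_def[symmetric] 1 2 A_def[symmetric] B_def[symmetric]
    by (simp add: field_simps power2_eq_square)
qed

text \<open>The first product vanishes when u is q^n with n >= 0, the second when u is q^(-(n+1));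
  together these are all integral powers.\<close>

lemma theta_prod_eq_0_iff:
  assumes "Im \<tau> > 0"
  shows "theta_prod \<tau> z = 0 \<longleftrightarrow> (\<exists>m::int. exp (2 * \<i> * z) = qpow \<tau> (of_int m))"
proof -
  define u where "u = exp (2 * \<i> * z)"
  define q where "q = qpow \<tau> 1"
  have [simp]: "u \<noteq> 0" "q \<noteq> 0" by (simp_all add: u_def q_def)
  have q1: "norm q < 1" using norm_qpow_less_1[OF assms, of 1] by (simp add: q_def)
  have e: "exp (- 2 * \<i> * z) = 1 / u" by (simp add: u_def exp_minus field_simps)
  have pos: "qpow \<tau> (of_int (int n)) = q ^ n" for n by (simp add: q_def qpow_of_nat)
  have neg: "qpow \<tau> (of_int (- int n)) = 1 / q ^ n" for n
    using qpow_add[of \<tau> "of_nat n" "- of_nat n"] by (simp add: q_def qpow_of_nat field_simps)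
  have "theta_prod \<tau> z = 0 \<longleftrightarrow> (\<exists>n. q ^ n * (1 / u) = 1) \<or> (\<exists>n. q ^ n * (q * u) = 1)"
    unfolding theta_prod_def e qpoch_eq_0_iff[OF q1, symmetric]
    unfolding u_def[symmetric] q_def[symmetric] by simp
  also have "(\<exists>n. q ^ n * (1 / u) = 1) \<longleftrightarrow> (\<exists>n. u = qpow \<tau> (of_int (int n)))"
    unfolding pos by (auto simp: field_simps)
  also have "(\<exists>n. q ^ n * (q * u) = 1) \<longleftrightarrow> (\<exists>n. u = qpow \<tau> (of_int (- int (Suc n))))"
    unfolding neg by (auto simp: field_simps)
  also have "(\<exists>n. u = qpow \<tau> (of_int (int n))) \<or> (\<exists>n. u = qpow \<tau> (of_int (- int (Suc n))))
      \<longleftrightarrow> (\<exists>m::int. u = qpow \<tau> (of_int m))"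
    by (metis int_cases)
  finally show ?thesis by (simp add: u_def)
qed

text \<open>This links the multiplicative condition on exp (2 \<i> y) with the lattice: it serves
  both for the zeros of the product and for the hypothesis on y in the final result.\<close>

lemma exp_eq_qpow_iff:
  "(\<exists>m::int. exp (2 * \<i> * z) = qpow \<tau> (of_int m)) \<longleftrightarrow> z \<in> period_lattice \<tau>"
proof -
  have "exp (2 * \<i> * z) = qpow \<tau> (of_int m)
      \<longleftrightarrow> (\<exists>n::int. z = of_int n * of_real pi + of_int m * of_real pi * \<tau>)" for m
  proof -
    have "2 * \<i> * z = 2 * of_real pi * \<i> * of_real (of_int m) * \<tau> + of_int (2 * n) * of_real pi * \<i>
      \<longleftrightarrow> z = of_int n * of_real pi + of_int m * of_real pi * \<tau>" for n
    proof -
      have "2 * of_real pi * \<i> * of_real (of_int m) * \<tau> + of_int (2 * n) * of_real pi * \<i>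
        = 2 * \<i> * (of_int n * of_real pi + of_int m * of_real pi * \<tau>)"
        by (simp add: algebra_simps)
      then show ?thesis by (simp only: mult_cancel_left) simp
    qed
    then show ?thesis unfolding qpow_def exp_eq by (simp add: mult_ac)
  qed
  then show ?thesis unfolding period_lattice_def by blast
qed

text \<open>The zero at 0 is simple: after splitting off 1 - exp (-2 \<i> z), the cofactor
  \<open>F\<close> takes the value (\<open>qpoch q q\<close>)^2 at 0, which is nonzero.\<close>

lemma theta_prod_deriv_0:
  assumes "Im \<tau> > 0"
  obtains d where "d \<noteq> 0" "(theta_prod \<tau> has_field_derivative d) (at 0)"
proof -
  define q where "q = qpow \<tau> 1"
  have q1: "norm q < 1" using norm_qpow_less_1[OF assms, of 1] by (simp add: q_def)
  define F where "F = (\<lambda>z. exp (\<i> * z) * qpoch q (q * exp (- 2 * \<i> * z)) * qpoch q (q * exp (2 * \<i> * z)))"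
  have "(\<lambda>z. qpoch q (q * exp (c * z))) holomorphic_on UNIV" for c
    using holomorphic_on_compose_gen[OF _ holomorphic_qpoch[OF q1], of "\<lambda>z. q * exp (c * z)" UNIV]
    by (simp add: o_def holomorphic_intros)
  note [holomorphic_intros] = this
  have "F holomorphic_on UNIV" unfolding F_def by (intro holomorphic_intros)
  then obtain F' where F': "(F has_field_derivative F') (at 0)"
    using holomorphic_on_imp_differentiable_at[of F UNIV 0] by (auto simp: field_differentiable_def)
  have eq: "theta_prod \<tau> = (\<lambda>z. (1 - exp (- 2 * \<i> * z)) * F z)"
  proof
    fix z
    show "theta_prod \<tau> z = (1 - exp (- 2 * \<i> * z)) * F z"
      unfolding theta_prod_def F_def q_def[symmetric]
      by (subst qpoch_rec[OF q1, of "exp (- 2 * \<i> * z)"]) (simp only: mult_ac)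
  qed
  have "(theta_prod \<tau> has_field_derivative (2 * \<i> * F 0)) (at 0)"
    unfolding eq by (rule derivative_eq_intros F' refl)+ simp
  moreover have "qpoch q q \<noteq> 0"
  proof
    assume "qpoch q q = 0"
    then obtain n where "q ^ n * q = 1" using qpoch_eq_0_iff[OF q1] by blast
    then have "1 - q ^ Suc n = 0" by (simp add: mult.commute)
    then show False using one_minus_power_neq_0[OF q1] by blast
  qed
  ultimately show thesis using that[of "2 * \<i> * F 0"] by (simp add: F_def)
qed

text \<open>With \<open>F 0 = 0\<close> this shows a singularity to be removable, and with
  \<open>F 0 = d\<close> it gives residue 1; both cases are used.\<close>

lemma times_divide_tendsto_at_0:
  fixes F G :: "complex \<Rightarrow> complex"
  assumes "isCont F 0" "(G has_field_derivative d) (at 0)" "G 0 = 0" "d \<noteq> 0"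
  shows "((\<lambda>w. w * (F w / G w)) \<longlongrightarrow> F 0 / d) (at 0)"
proof -
  have "((\<lambda>w. G w / w) \<longlongrightarrow> d) (at 0)"
    using assms(2,3) by (simp add: has_field_derivative_iff)
  then have "((\<lambda>w. F w / (G w / w)) \<longlongrightarrow> F 0 / d) (at 0)"
    using assms(1,4) by (intro tendsto_intros) (simp add: isCont_def)
  then show ?thesis by (simp add: mult_ac)
qed

lemma times_tendsto_0_if_isCont:
  fixes F :: "complex \<Rightarrow> complex"
  assumes "isCont F z"
  shows "((\<lambda>w. (w - z) * F w) \<longlongrightarrow> 0) (at z)"
proof -
  have "((\<lambda>w. (w - z) * F w) \<longlongrightarrow> (z - z) * F z) (at z)"
    using assms by (intro tendsto_intros) (simp add: isCont_def)
  then show ?thesis by simp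
qed

section \<open>Identification of the theta function with the product\<close>

lemma uminus_period_lattice: "l \<in> period_lattice \<tau> \<Longrightarrow> - l \<in> period_lattice \<tau>"
proof -
  assume "l \<in> period_lattice \<tau>"
  then obtain m n :: int where "l = of_int m * of_real pi + of_int n * of_real pi * \<tau>"
    by (auto simp: period_lattice_def)
  then have "- l = of_int (- m) * of_real pi + of_int (- n) * of_real pi * \<tau>" by simp
  then show ?thesis unfolding period_lattice_def by blast
qed

lemma zero_in_period_lattice: "0 \<in> period_lattice \<tau>"
  unfolding period_lattice_def by (intro CollectI exI[of _ 0]) simp

lemma isCont_if_entire: "F holomorphic_on UNIV \<Longrightarrow> isCont F z" for F :: "complex \<Rightarrow> complex"
  using holomorphic_on_imp_continuous_on continuous_on_eq_continuous_at open_UNIV by blast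

lemma theta1_eq_theta_prod:
  assumes "Im \<tau> > 0"
  obtains C where "C \<noteq> 0" "\<And>z. theta1 \<tau> z = C * theta_prod \<tau> z"
proof -
  note cont = isCont_if_entire[OF holomorphic_theta1[OF assms]]
    isCont_if_entire[OF holomorphic_theta_prod[OF assms]]
  define g where "g = (\<lambda>z. theta1 \<tau> z / theta_prod \<tau> z)"
  have P0: "theta_prod \<tau> z = 0 \<longleftrightarrow> z \<in> period_lattice \<tau>" for z
    using theta_prod_eq_0_iff[OF assms] exp_eq_qpow_iff by blast
  obtain C and m :: int where C: "\<forall>\<^sub>\<approx>z. g z = C * exp (2 * \<i> * of_int m * z)"
    "C = 0 \<or> 1 = exp (2 * \<i> * of_int m * (of_real pi * \<tau>))"
  proof (rule meromorphic_quasi_elliptic[OF assms])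
    have "F meromorphic_on UNIV" if "F holomorphic_on UNIV" for F
      using that by (intro analytic_on_imp_meromorphic_on) (simp add: analytic_on_open)
    then show "g meromorphic_on UNIV"
      unfolding g_def
      using holomorphic_theta1[OF assms] holomorphic_theta_prod[OF assms]
      by (intro meromorphic_on_divide) auto
    show "\<forall>\<^sub>\<approx>z. g (z + of_real pi) = g z"
      by (simp add: g_def theta1_add_pi[OF assms] theta_prod_add_pi)
    show "\<forall>\<^sub>\<approx>z. g (z + of_real pi * \<tau>) = 1 * g z"
      unfolding g_def theta1_add_pi_tau[OF assms] theta_prod_add_pi_tau[OF assms] by simp
    show "\<exists>l\<in>period_lattice \<tau>. ((\<lambda>w. (w - (z + l)) * g w) \<longlongrightarrow> 0) (at (z + l))" for z
    proof (cases "z \<in> period_lattice \<tau>")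
      case True
      obtain d where d: "d \<noteq> 0" "(theta_prod \<tau> has_field_derivative d) (at 0)"
        using theta_prod_deriv_0[OF assms] .
      \<comment> \<open>The lattice points are represented by 0, where the zero of
        \<open>theta1\<close> cancels the simple zero of the product.\<close>
      have "((\<lambda>w. w * g w) \<longlongrightarrow> 0) (at 0)"
        using times_divide_tendsto_at_0[OF cont(1) d(2) _ d(1)]
        by (simp add: g_def P0 zero_in_period_lattice)
      then show ?thesis using True by (intro bexI[of _ "- z"]) (simp_all add: uminus_period_lattice)
    next
      case False
      then have "isCont g z"
        unfolding g_def by (intro continuous_intros cont) (simp add: P0)
      then show ?thesis
        using times_tendsto_0_if_isCont by (intro bexI[of _ 0]) (simp_all add: zero_in_period_lattice)
    qed
    show "(1::complex) \<noteq> 0" by simp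
  qed blast
  \<comment> \<open>The formula for the quotient is known only off a sparse set; both sides of the
    multiplied-out form are continuous, so it extends to every point.\<close>
  have eq: "theta1 \<tau> z = C * exp (2 * \<i> * of_int m * z) * theta_prod \<tau> z" for z
  proof (rule tendsto_unique[OF at_neq_bot])
    have "\<forall>\<^sub>\<approx>z. theta_prod \<tau> z \<noteq> 0"
    proof -
      obtain d where d: "d \<noteq> 0" "(theta_prod \<tau> has_field_derivative d) (at 0)"
        using theta_prod_deriv_0[OF assms] .
      have "\<not> (\<forall>z. theta_prod \<tau> z = 0)"
      proof
        assume "\<forall>z. theta_prod \<tau> z = 0"
        then have "theta_prod \<tau> = (\<lambda>_. 0)" by blast
        then show False using d DERIV_unique[OF d(2), of 0] by simp
      qed
      then obtain z where "theta_prod \<tau> z \<noteq> 0" by blast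
      then show ?thesis
        using non_zero_neighbour_alt[OF holomorphic_theta_prod[OF assms], of _ z]
        by (auto simp: eventually_cosparse_open_eq elim!: eventually_mono)
    qed
    with C(1) have "\<forall>\<^sub>\<approx>z. C * exp (2 * \<i> * of_int m * z) * theta_prod \<tau> z = theta1 \<tau> z"
      by eventually_elim (simp add: g_def nonzero_divide_eq_eq)
    then have ev: "eventually (\<lambda>w. C * exp (2 * \<i> * of_int m * w) * theta_prod \<tau> w = theta1 \<tau> w) (at z)"
      by (simp add: eventually_cosparse_open_eq)
    show "(theta1 \<tau> \<longlongrightarrow> theta1 \<tau> z) (at z)" using cont(1) by (simp add: isCont_def)
    have "isCont (\<lambda>w. C * exp (2 * \<i> * of_int m * w) * theta_prod \<tau> w) z"
      by (intro continuous_intros cont)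
    then show "(theta1 \<tau> \<longlongrightarrow> C * exp (2 * \<i> * of_int m * z) * theta_prod \<tau> z) (at z)"
      unfolding isCont_def using ev by (rule Lim_transform_eventually)
  qed
  have "C \<noteq> 0" using theta1_not_identically_0[OF assms] eq by auto
  \<comment> \<open>This modulus equals exp (-2 pi m Im \<tau>), which is 1 only for m = 0.\<close>
  then have "norm (exp (2 * \<i> * of_int m * (of_real pi * \<tau>))) = 1" using C(2) by (metis norm_one)
  then have "m = 0" using assms by simp
  then show thesis using that \<open>C \<noteq> 0\<close> eq by simp
qed

lemma theta1_eq_0_iff:
  assumes "Im \<tau> > 0"
  shows "theta1 \<tau> z = 0 \<longleftrightarrow> z \<in> period_lattice \<tau>"
proof -
  obtain C where "C \<noteq> 0" "\<And>z. theta1 \<tau> z = C * theta_prod \<tau> z"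
    using theta1_eq_theta_prod[OF assms] by metis
  then show ?thesis using theta_prod_eq_0_iff[OF assms] exp_eq_qpow_iff by simp
qed

lemma deriv_theta1_0_neq_0:
  assumes "Im \<tau> > 0"
  shows "deriv (theta1 \<tau>) 0 \<noteq> 0"
proof -
  obtain C where C: "C \<noteq> 0" "\<And>z. theta1 \<tau> z = C * theta_prod \<tau> z"
    using theta1_eq_theta_prod[OF assms] by metis
  obtain d where d: "d \<noteq> 0" "(theta_prod \<tau> has_field_derivative d) (at 0)"
    using theta_prod_deriv_0[OF assms] .
  have "theta1 \<tau> = (\<lambda>z. C * theta_prod \<tau> z)" using C(2) by blast
  then have "(theta1 \<tau> has_field_derivative (C * d)) (at 0)"
    using DERIV_cmult[OF d(2), of C] by simp
  then show ?thesis using C(1) d(1) by (simp add: DERIV_imp_deriv)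
qed

subsection \<open>The Kronecker theta function\<close>

lemma kronecker_theta_add_pi:
  assumes "Im \<tau> > 0"
  shows "kronecker_theta \<tau> y (z + of_real pi) = kronecker_theta \<tau> y z"
  using theta1_add_pi[OF assms, of z] theta1_add_pi[OF assms, of "z + y"]
  by (simp add: kronecker_theta_def add_ac)

text \<open>The multipliers of \<open>theta1\<close> at \<open>z + y\<close> and at \<open>z\<close>
  differ by the factor exp (-2 \<i> y). The equation holds at every z: if \<open>theta1\<close>
  vanishes at z it does so at the translate, and both sides are 0 by the convention for
  division.\<close>

lemma kronecker_theta_add_pi_tau:
  assumes "Im \<tau> > 0"
  shows "kronecker_theta \<tau> y (z + of_real pi * \<tau>) = exp (- 2 * \<i> * y) * kronecker_theta \<tau> y z"
proof -
  have "exp (- 2 * \<i> * (z + y)) = exp (- 2 * \<i> * y) * exp (- 2 * \<i> * z)"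
    by (simp only: distrib_left exp_add mult.commute[of "exp (- 2 * \<i> * y)"])
  moreover have "z + of_real pi * \<tau> + y = (z + y) + of_real pi * \<tau>" by simp
  ultimately have "theta1 \<tau> (z + of_real pi * \<tau> + y)
      = exp (- 2 * \<i> * y) * (- (exp (- 2 * \<i> * z) / qpow \<tau> (1/2)) * theta1 \<tau> (z + y))"
    by (simp only: theta1_add_pi_tau[OF assms] mult_minus_left mult_minus_right
        times_divide_eq_left times_divide_eq_right mult.assoc)
  then show ?thesis
    unfolding kronecker_theta_def theta1_add_pi_tau[OF assms] by simp
qed

lemma meromorphic_kronecker_theta:
  assumes "Im \<tau> > 0"
  shows "(\<lambda>z. kronecker_theta \<tau> y (z - a)) meromorphic_on UNIV"
proof -
  have "(\<lambda>z. theta1 \<tau> (z - b)) meromorphic_on UNIV" for b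
    using holomorphic_on_compose_gen[OF _ holomorphic_theta1[OF assms], of "\<lambda>z. z - b" UNIV]
    by (intro analytic_on_imp_meromorphic_on) (simp add: analytic_on_open o_def holomorphic_intros)
  from this[of a] this[of "a - y"] show ?thesis
    unfolding kronecker_theta_def by (intro meromorphic_intros) (simp_all add: algebra_simps)
qed

lemma kronecker_theta_residue_at_0:
  assumes "Im \<tau> > 0" "y \<notin> period_lattice \<tau>"
  shows "((\<lambda>w. w * kronecker_theta \<tau> y w) \<longlongrightarrow> 1) (at 0)"
proof -
  define c where "c = deriv (theta1 \<tau>) 0"
  have c: "c \<noteq> 0" unfolding c_def by (rule deriv_theta1_0_neq_0[OF assms(1)])
  have y: "theta1 \<tau> y \<noteq> 0" using assms by (simp add: theta1_eq_0_iff)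
  have "(theta1 \<tau> has_field_derivative c) (at 0)"
    unfolding c_def using holomorphic_theta1[OF assms(1)] by (rule holomorphic_derivI) auto
  moreover have "isCont (\<lambda>w. c * theta1 \<tau> (w + y) / theta1 \<tau> y) 0"
    by (intro continuous_intros isCont_o2[OF _ isCont_if_entire[OF holomorphic_theta1[OF assms(1)]]] y)
  ultimately have "((\<lambda>w. w * ((c * theta1 \<tau> (w + y) / theta1 \<tau> y) / theta1 \<tau> w))
      \<longlongrightarrow> (c * theta1 \<tau> (0 + y) / theta1 \<tau> y) / c) (at 0)"
    using c by (intro times_divide_tendsto_at_0) simp_all
  then show ?thesis using c y by (simp add: kronecker_theta_def c_def mult_ac)
qed

text \<open>Points equivalent to but different from \<open>a\<close> are left out: they are poles as
  well, with a residue that the multiplier can change.\<close>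

lemma kronecker_theta_translate_tendsto:
  assumes "Im \<tau> > 0" "y \<notin> period_lattice \<tau>" "z = a \<or> z - a \<notin> period_lattice \<tau>"
  shows "((\<lambda>w. (w - z) * kronecker_theta \<tau> y (w - a)) \<longlongrightarrow> (if z = a then 1 else 0)) (at z)"
proof (cases "z = a")
  case True
  then show ?thesis
    using LIM_offset[OF kronecker_theta_residue_at_0[OF assms(1,2)], of "- a"] by simp
next
  case False
  have "isCont (\<lambda>w. kronecker_theta \<tau> y (w - a)) z"
    unfolding kronecker_theta_def
    by (intro continuous_intros isCont_o2[OF _ isCont_if_entire[OF holomorphic_theta1[OF assms(1)]]])
      (use assms False in \<open>simp add: theta1_eq_0_iff\<close>)
  then show ?thesis using times_tendsto_0_if_isCont False by simp
qed

section \<open>Residues at simple poles and the expansion of f\<close>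

lemma simple_pole_tendsto_residue:
  assumes "f meromorphic_on {z}" "is_pole f z" "zorder f z = -1"
  shows "((\<lambda>w. (w - z) * f w) \<longlongrightarrow> residue f z) (at z)"
proof -
  have iso: "isolated_singularity_at f z"
    by (rule meromorphic_on_isolated_singularity[OF assms(1)])
  have "\<exists>\<^sub>F w in at z. f w \<noteq> 0"
    using non_zero_neighbour_pole[OF assms(2)] by (auto elim: eventually_frequentlyE)
  then obtain r where r: "r > 0" "zor_poly f z holomorphic_on cball z r"
    using zorder_exist[OF iso meromorphic_on_not_essential[OF assms(1)]] by blast
  then have "continuous_on (ball z r) (zor_poly f z)"
    by (intro holomorphic_on_imp_continuous_on) auto
  then have "(zor_poly f z \<longlongrightarrow> zor_poly f z z) (at z)"
    using r(1) by (auto simp: continuous_on_eq_continuous_at isCont_def)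
  \<comment> \<open>At order -1, \<open>zor_poly\<close> is (w - z) f(w) off the pole, and its value
    at the pole is the residue.\<close>
  moreover have "eventually (\<lambda>w. zor_poly f z w = (w - z) * f w) (at z)"
    using zor_poly_pole_eq[OF iso assms(2)] by (simp add: assms(3) mult.commute)
  ultimately show ?thesis
    unfolding residue_simple_pole[OF iso assms(2,3)] by (rule Lim_transform_eventually)
qed

theorem theorem1p7:
  fixes \<tau> y :: complex and f :: "complex \<Rightarrow> complex"
    and n :: nat and a :: "nat \<Rightarrow> complex"
  assumes "Im \<tau> > 0"
    and "\<forall>m::int. exp (2 * \<i> * y) \<noteq> qpow \<tau> (of_int m)"
    and "f meromorphic_on UNIV"
    and "only_simple_poles f"
    and "inj_on a {1..n}"
    and "complete_inequivalent_poles \<tau> f (a ` {1..n})"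
    and "\<forall>\<^sub>\<approx>z. f z = f (z + of_real pi)"
    and "\<forall>\<^sub>\<approx>z. f z = exp (2 * \<i> * y) * f (z + of_real pi * \<tau>)"
  shows "\<forall>\<^sub>\<approx>z. f z = (\<Sum>k=1..n. residue f (a k) * kronecker_theta \<tau> y (z - a k))"
proof -
  note \<tau> = \<open>Im \<tau> > 0\<close>
  have y: "y \<notin> period_lattice \<tau>" using assms(2) exp_eq_qpow_iff by blast
  have mero: "f meromorphic_on {z}" for z using assms(3) by (rule meromorphic_on_subset) simp
  have pole: "is_pole f (a k)" if "k \<in> {1..n}" for k
    using assms(6) that by (auto simp: complete_inequivalent_poles_def)
  have ineq: "a k - a j \<notin> period_lattice \<tau>" if "k \<in> {1..n}" "j \<in> {1..n}" "k \<noteq> j" for k j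
  proof -
    have "a k \<noteq> a j" using inj_onD[OF assms(5)] that by blast
    then show ?thesis
      using assms(6) that unfolding complete_inequivalent_poles_def lattice_equiv_def by blast
  qed
  define g where "g = (\<lambda>z. f z - (\<Sum>k=1..n. residue f (a k) * kronecker_theta \<tau> y (z - a k)))"
  obtain C and m :: int where C: "\<forall>\<^sub>\<approx>z. g z = C * exp (2 * \<i> * of_int m * z)"
    "C = 0 \<or> exp (- 2 * \<i> * y) = exp (2 * \<i> * of_int m * (of_real pi * \<tau>))"
  proof (rule meromorphic_quasi_elliptic[OF \<tau>])
    show "g meromorphic_on UNIV"
      unfolding g_def by (intro meromorphic_intros assms(3) meromorphic_kronecker_theta \<tau>)
    show "\<forall>\<^sub>\<approx>z. g (z + of_real pi) = g z"
      using assms(7)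
    proof eventually_elim
      case (elim z)
      have "kronecker_theta \<tau> y (z + of_real pi - b) = kronecker_theta \<tau> y (z - b)" for b
        using kronecker_theta_add_pi[OF \<tau>, of y "z - b"] by (simp add: algebra_simps)
      then show ?case using elim by (simp add: g_def)
    qed
    show "\<forall>\<^sub>\<approx>z. g (z + of_real pi * \<tau>) = exp (- 2 * \<i> * y) * g z"
      using assms(8)
    proof eventually_elim
      case (elim z)
      have "f (z + of_real pi * \<tau>) = exp (- 2 * \<i> * y) * f z"
        by (subst elim) (simp add: mult.assoc[symmetric] flip: exp_add)
      moreover have "kronecker_theta \<tau> y (z + of_real pi * \<tau> - b)
          = exp (- 2 * \<i> * y) * kronecker_theta \<tau> y (z - b)" for b
        using kronecker_theta_add_pi_tau[OF \<tau>, of y "z - b"] by (simp add: algebra_simps)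
      ultimately show ?case
        by (simp add: g_def sum_distrib_left right_diff_distrib mult_ac)
    qed
    show "\<exists>l\<in>period_lattice \<tau>. ((\<lambda>w. (w - (z + l)) * g w) \<longlongrightarrow> 0) (at (z + l))" for z
    proof -
      \<comment> \<open>At \<open>x\<close> the sum contributes the residue of the summand centred
        at \<open>x\<close>, if there is one; every other summand is continuous there and
        contributes 0.\<close>
      have g_lim: "((\<lambda>w. (w - x) * g w) \<longlongrightarrow>
          r - (\<Sum>k=1..n. residue f (a k) * (if x = a k then 1 else 0))) (at x)"
        if "((\<lambda>w. (w - x) * f w) \<longlongrightarrow> r) (at x)"
          and "\<And>k. k \<in> {1..n} \<Longrightarrow> x = a k \<or> x - a k \<notin> period_lattice \<tau>" for x r
      proof -
        have "((\<lambda>w. (w - x) * f w - (\<Sum>k=1..n. residue f (a k) * ((w - x) * kronecker_theta \<tau> y (w - a k))))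
          \<longlongrightarrow> r - (\<Sum>k=1..n. residue f (a k) * (if x = a k then 1 else 0))) (at x)"
          using that by (intro tendsto_intros kronecker_theta_translate_tendsto \<tau> y) auto
        then show ?thesis
          by (simp only: g_def right_diff_distrib sum_distrib_left mult.left_commute)
      qed
      show ?thesis
      \<comment> \<open>A point equivalent to some \<open>a k\<close> is represented by
        \<open>a k\<close>, where the residues cancel; any other point represents itself and is a
        pole neither of f nor of a summand.\<close>
      proof (cases "\<exists>k\<in>{1..n}. z - a k \<in> period_lattice \<tau>")
        case True
        then obtain k where k: "k \<in> {1..n}" "z - a k \<in> period_lattice \<tau>" by blast
        have "((\<lambda>w. (w - a k) * f w) \<longlongrightarrow> residue f (a k)) (at (a k))"
          using simple_pole_tendsto_residue[OF mero pole[OF k(1)]] assms(4) pole[OF k(1)]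
          by (simp add: only_simple_poles_def)
        from g_lim[OF this] have "((\<lambda>w. (w - a k) * g w) \<longlongrightarrow>
            residue f (a k) - (\<Sum>j=1..n. residue f (a j) * (if a k = a j then 1 else 0))) (at (a k))"
          using ineq[OF k(1)] by blast
        \<comment> \<open>By injectivity of \<open>a\<close>, only the index k itself gives the pole
          \<open>a k\<close>.\<close>
        also have "(\<Sum>j=1..n. residue f (a j) * (if a k = a j then 1 else 0))
            = (\<Sum>j=1..n. if j = k then residue f (a j) else 0)"
          by (intro sum.cong) (use inj_onD[OF assms(5)] k(1) in auto)
        also have "\<dots> = residue f (a k)" using k(1) by simp
        finally show ?thesis
          using uminus_period_lattice[OF k(2)] by (intro bexI[of _ "a k - z"]) auto
      next
        case False
        then have "\<not> is_pole f z"
          using assms(6) by (auto simp: complete_inequivalent_poles_def lattice_equiv_def)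
        then obtain L where "(f \<longlongrightarrow> L) (at z)"
          using meromorphic_on_not_essential[OF mero, of z] by (auto simp: not_essential_def)
        then have "((\<lambda>w. (w - z) * f w) \<longlongrightarrow> (z - z) * L) (at z)"
          by (intro tendsto_intros)
        then have "((\<lambda>w. (w - z) * g w) \<longlongrightarrow>
            0 - (\<Sum>k=1..n. residue f (a k) * (if z = a k then 1 else 0))) (at z)"
          using False by (intro g_lim) auto
        moreover have "(\<Sum>k=1..n. residue f (a k) * (if z = a k then 1 else 0)) = 0"
          using False zero_in_period_lattice by (intro sum.neutral) auto
        ultimately show ?thesis by (intro bexI[of _ 0]) (simp_all add: zero_in_period_lattice)
      qed
    qed
    show "exp (- 2 * \<i> * y) \<noteq> 0" by simp
  qed blast
  have "C = 0"
  proof (rule ccontr)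
    assume "C \<noteq> 0"
    then have "exp (- 2 * \<i> * y) = exp (2 * \<i> * of_int m * (of_real pi * \<tau>))" using C(2) by blast
    then have "inverse (exp (- 2 * \<i> * y)) = inverse (exp (2 * \<i> * of_int m * (of_real pi * \<tau>)))" by simp
    \<comment> \<open>Inverting the multiplier exhibits exp (2 \<i> y) as q^(-m), which the
      hypothesis on y excludes.\<close>
    then have "exp (2 * \<i> * y) = qpow \<tau> (of_int (- m))"
      by (simp add: qpow_def mult_ac flip: exp_minus)
    then show False using assms(2) by blast
  qed
  with C(1) show ?thesis by (auto simp: g_def elim!: eventually_mono)
qed

end
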